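(* There exist a graph $G$, a positive integer $m$, and an $m$-weighting $w$ of $G$ such that $\pi_3(G(w)) < \pi_3(G(w'))$ for every uniform-$\alpha$ $m$-weighting $w'$ of $G$.
   Context: All graphs are simple. $\mathbb{N}_0 = \{0,1,2,\dots\}$. For a graph $G$, a function $w: V(G) \to \mathbb{N}_0$ with $\sum_{v \in V(G)} w(v) = m$ is an $m$-weighting of $G$. $G(w)$ is the graph obtained from $G$ by replacing each vertex $v$ by a clique $K^v$ on $w(v)$ vertices and joining every vertex of $K^u$ to every vertex of $K^v$ whenever $uv \in E(G)$. $\pi_3(H)$ denotes the number of triangles ($3$-cliques) of a graph $H$. An $m$-weighting $w$ is uniform on $U \subseteq V(G)$ if $w(v)=0$ for all $v \notin U$ and $w(u) \in \{\lfloor m/|U|\rfloor, \lceil m/|U| \rceil\}$ for all $u \in U$; $w$ is uniform-$\alpha$ if it is uniform on some independent set of $G$ of maximum size. *)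

theory Defs
  imports Complex_Main "Graph_Theory.Pair_Digraph"
begin

text \<open>Finite simple graphs are rendered by the locale \<^locale>\<open>pair_graph\<close>: a finite vertex set
  with a symmetric, irreflexive adjacency relation, so an edge \<open>uv\<close> is represented by both
  arcs \<open>(u, v)\<close> and \<open>(v, u)\<close>.\<close>

definition is_clique :: "'a pair_pre_digraph \<Rightarrow> 'a set \<Rightarrow> bool" where
  "is_clique G T \<longleftrightarrow> T \<subseteq> pverts G \<and> (\<forall>u\<in>T. \<forall>v\<in>T. u \<noteq> v \<longrightarrow> (u, v) \<in> parcs G)"

definition num_triangles :: "'a pair_pre_digraph \<Rightarrow> nat"  (\<open>\<pi>\<^sub>3\<close>) where
  "\<pi>\<^sub>3 G = card {T. is_clique G T \<and> card T = 3}"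

definition is_independent :: "'a pair_pre_digraph \<Rightarrow> 'a set \<Rightarrow> bool" where
  "is_independent G U \<longleftrightarrow> U \<subseteq> pverts G \<and> (\<forall>u\<in>U. \<forall>v\<in>U. (u, v) \<notin> parcs G)"

definition is_max_independent :: "'a pair_pre_digraph \<Rightarrow> 'a set \<Rightarrow> bool" where
  "is_max_independent G U \<longleftrightarrow>
     is_independent G U \<and> (\<forall>U'. is_independent G U' \<longrightarrow> card U' \<le> card U)"

text \<open>Only the values of a weighting on the vertex set matter.\<close>

definition weighting :: "'a pair_pre_digraph \<Rightarrow> nat \<Rightarrow> ('a \<Rightarrow> nat) \<Rightarrow> bool" where
  "weighting G m w \<longleftrightarrow> (\<Sum>v\<in>pverts G. w v) = m"

text \<open>The clique replacing \<open>v\<close> has vertices \<open>(v, 0), \<dots>, (v, w v - 1)\<close>.\<close>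

definition blowup :: "'a pair_pre_digraph \<Rightarrow> ('a \<Rightarrow> nat) \<Rightarrow> ('a \<times> nat) pair_pre_digraph" where
  "blowup G w =
     \<lparr> pverts = {(v, i). v \<in> pverts G \<and> i < w v},
       parcs = {((u, i), (v, j)). u \<in> pverts G \<and> i < w u \<and> v \<in> pverts G \<and> j < w v \<and>
                  (u = v \<and> i \<noteq> j \<or> (u, v) \<in> parcs G)} \<rparr>"

definition uniform_on :: "'a pair_pre_digraph \<Rightarrow> nat \<Rightarrow> ('a \<Rightarrow> nat) \<Rightarrow> 'a set \<Rightarrow> bool" where
  "uniform_on G m w U \<longleftrightarrow>
     weighting G m w \<and> U \<subseteq> pverts G \<and> (\<forall>v \<in> pverts G - U. w v = 0) \<and>
     (\<forall>u\<in>U. int (w u) \<in> {\<lfloor>real m / real (card U)\<rfloor>, \<lceil>real m / real (card U)\<rceil>})"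

definition uniform_alpha :: "'a pair_pre_digraph \<Rightarrow> nat \<Rightarrow> ('a \<Rightarrow> nat) \<Rightarrow> bool" where
  "uniform_alpha G m w \<longleftrightarrow> (\<exists>U. is_max_independent G U \<and> uniform_on G m w U)"

end

theory Submission
  imports Defs
begin

text \<open>Take \<open>C\<^sub>5\<close> with \<open>m = 5\<close> and all weights equal to 1. The blow-up is \<open>C\<^sub>5\<close> itself,
  which is triangle-free. An independent set has at most two vertices, so a 5-weighting supported
  on one puts weight at least 3 on some vertex, and the clique replacing it contains a triangle.\<close>

lemma finite_pverts_blowup:
  assumes "finite (pverts G)"
  shows "finite (pverts (blowup G w))"
proof -
  have "pverts (blowup G w) = Sigma (pverts G) (\<lambda>v. {..<w v})"
    by (auto simp: blowup_def)
  then show ?thesis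
    using assms by simp
qed

lemma num_triangles_blowup_pos:
  assumes "finite (pverts G)" "v \<in> pverts G" "3 \<le> w v"
  shows "0 < \<pi>\<^sub>3 (blowup G w)"
proof -
  let ?C = "{T. is_clique (blowup G w) T \<and> card T = 3}"
  have "?C \<subseteq> Pow (pverts (blowup G w))"
    by (auto simp: is_clique_def)
  \<comment> \<open>\<open>card\<close> of an infinite set is 0, so exhibiting a member of
    \<open>?C\<close> proves positivity only once \<open>?C\<close> is known to be finite.\<close>
  then have "finite ?C"
    using finite_pverts_blowup[OF assms(1)] by (meson finite_Pow_iff finite_subset)
  moreover have "Pair v ` {..<3} \<in> ?C"
    using assms by (auto simp: is_clique_def blowup_def card_image inj_on_def)
  ultimately show ?thesis
    unfolding num_triangles_def card_gt_0_iff by blast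
qed

text \<open>Each clique of this blow-up is a single vertex, so \<open>fst\<close> is injective on
  vertices and sends distinct triangles to distinct triangles of \<open>G\<close>. The upper bound
  suffices because it is applied where the right side is 0.\<close>

lemma num_triangles_blowup_one:
  assumes "finite (pverts G)"
  shows "\<pi>\<^sub>3 (blowup G (\<lambda>_. 1)) \<le> \<pi>\<^sub>3 G"
proof -
  let ?B = "blowup G (\<lambda>_. 1)"
  let ?C = "{T. is_clique ?B T \<and> card T = 3}" and ?D = "{T. is_clique G T \<and> card T = 3}"
  have inj: "inj_on fst (pverts ?B)"
    by (auto simp: inj_on_def blowup_def)
  have sub: "T \<subseteq> pverts ?B" if "is_clique ?B T" for T
    using that by (simp add: is_clique_def)
  have "inj_on ((`) fst) ?C"
    by (rule inj_on_subset[OF inj_on_image_Pow[OF inj]]) (use sub in auto)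
  moreover have "(`) fst ` ?C \<subseteq> ?D"
  proof (clarify, intro conjI)
    fix T assume T: "is_clique ?B T" "card T = 3"
    show "is_clique G (fst ` T)"
      using T(1) by (fastforce simp: is_clique_def blowup_def)
    show "card (fst ` T) = 3"
      using T inj_on_subset[OF inj sub[OF T(1)]] by (simp add: card_image)
  qed
  moreover have "finite ?D"
    by (rule finite_subset[of _ "Pow (pverts G)"]) (use assms in \<open>auto simp: is_clique_def\<close>)
  ultimately show ?thesis
    unfolding num_triangles_def by (rule card_inj_on_le)
qed

text \<open>Pigeonhole: \<open>w\<close> vanishes off \<open>U\<close>, so the whole weight
  \<open>m\<close> lies on \<open>U\<close>, and values of at most \<open>k\<close> there would add
  up to at most \<open>card U * k\<close>.\<close>

lemma uniform_on_exists_large: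
  assumes "finite (pverts G)" "uniform_on G m w U" "card U * k < m"
  obtains u where "u \<in> U" "k < w u"
proof -
  have "(\<Sum>v\<in>U. w v) = (\<Sum>v\<in>pverts G. w v)"
    using assms(1,2) by (intro sum.mono_neutral_left) (auto simp: uniform_on_def)
  then have "(\<Sum>v\<in>U. w v) = m"
    using assms(2) by (simp add: uniform_on_def weighting_def)
  then have "\<not> (\<forall>u\<in>U. w u \<le> k)"
    using assms(3) sum_bounded_above[of U w k] by auto
  then show ?thesis
    using that by (auto simp: not_le)
qed

definition C5 :: "nat pair_pre_digraph" where
  "C5 = \<lparr> pverts = {..<5},
          parcs = {(u, v). u < 5 \<and> v < 5 \<and>
                     (v = u + 1 \<or> u = v + 1 \<or> u = 0 \<and> v = 4 \<or> u = 4 \<and> v = 0)} \<rparr>"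

lemma finite_pverts_C5: "finite (pverts C5)"
  by (simp add: C5_def)

lemma pair_graph_C5: "pair_graph C5"
proof
  have "parcs C5 \<subseteq> pverts C5 \<times> pverts C5"
    by (auto simp: C5_def)
  then show "finite (parcs C5)"
    using finite_pverts_C5 by (meson finite_SigmaI finite_subset)
  show "symmetric C5"
    unfolding symmetric_def by (rule symI) (simp add: C5_def, presburger)
qed (auto simp: C5_def)

text \<open>Around a triangle the three differences would each be 1 or -1 modulo 5 and sum to 0, but
  three such signs sum to an odd number between -3 and 3.\<close>

lemma num_triangles_C5: "\<pi>\<^sub>3 C5 = 0"
proof -
  have False if "is_clique C5 T" "card T = 3" for T
  proof -
    from \<open>card T = 3\<close> obtain x y z where "T = {x, y, z}" "x \<noteq> y" "y \<noteq> z" "x \<noteq> z"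
      by (metis card_3_iff)
    with \<open>is_clique C5 T\<close> have "(x, y) \<in> parcs C5" "(y, z) \<in> parcs C5" "(x, z) \<in> parcs C5"
      by (auto simp: is_clique_def)
    then show False
      by (simp add: C5_def) presburger
  qed
  then show ?thesis
    unfolding num_triangles_def by (metis (mono_tags, lifting) card.empty empty_Collect_eq)
qed

text \<open>Distinct non-adjacent vertices differ by 2 or -2 modulo 5. Three of them would give
  differences summing to 2, -2, 6 or -6, none divisible by 5.\<close>

lemma card_independent_C5:
  assumes "is_independent C5 U"
  shows "card U \<le> 2"
proof (rule ccontr)
  assume "\<not> card U \<le> 2"
  then obtain T where "T \<subseteq> U" "card T = 3"
    by (metis Suc_leI eval_nat_numeral(3) not_le obtain_subset_with_card_n)
  then obtain x y z where "{x, y, z} \<subseteq> U" and ne: "x \<noteq> y" "y \<noteq> z" "x \<noteq> z"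
    by (metis card_3_iff)
  with assms have "x \<in> pverts C5" "y \<in> pverts C5" "z \<in> pverts C5"
    "(x, y) \<notin> parcs C5" "(y, z) \<notin> parcs C5" "(x, z) \<notin> parcs C5"
    by (auto simp: is_independent_def)
  with ne show False
    by (simp add: C5_def) presburger
qed

theorem theorem8:
  shows "\<exists>(G :: nat pair_pre_digraph) (m :: nat) (w :: nat \<Rightarrow> nat).
    pair_graph G \<and> m > 0 \<and> weighting G m w \<and>
    (\<forall>w'. uniform_alpha G m w' \<longrightarrow> \<pi>\<^sub>3 (blowup G w) < \<pi>\<^sub>3 (blowup G w'))"
proof (intro exI conjI allI impI)
  show "pair_graph C5"
    by (rule pair_graph_C5)
  show "(5::nat) > 0"
    by simp
  show "weighting C5 5 (\<lambda>_. 1)"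
    by (simp add: weighting_def C5_def)
  fix w' assume "uniform_alpha C5 5 w'"
  then obtain U where U: "is_independent C5 U" "uniform_on C5 5 w' U"
    by (auto simp: uniform_alpha_def is_max_independent_def)
  \<comment> \<open>The choice \<open>k = 2\<close> forces a weight of at least 3, just enough for a
    triangle inside one clique.\<close>
  have "card U * 2 < 5"
    using card_independent_C5[OF U(1)] by simp
  with finite_pverts_C5 U(2) obtain u where "u \<in> U" "2 < w' u"
    by (rule uniform_on_exists_large)
  then have "0 < \<pi>\<^sub>3 (blowup C5 w')"
    using U(1) by (intro num_triangles_blowup_pos[OF finite_pverts_C5]) (auto simp: is_independent_def)
  then show "\<pi>\<^sub>3 (blowup C5 (\<lambda>_. 1)) < \<pi>\<^sub>3 (blowup C5 w')"
    using num_triangles_blowup_one[OF finite_pverts_C5] num_triangles_C5 by simp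
qed

end
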